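(* Let $G$ be a threshold graph. Then every eigenvalue $\lambda$ of the adjacency matrix of $G$ with $\lambda\notin\{-1,0\}$ satisfies $\lambda\notin\left[\frac{-1-\sqrt2}{2},\,\frac{-1+\sqrt2}{2}\right]$.
   Context: All graphs are finite, simple and undirected. A threshold graph is a graph that can be constructed from a one-vertex graph by repeatedly adding either a single isolated vertex or a single vertex adjacent to all existing vertices. The eigenvalues of a graph are the eigenvalues of its adjacency matrix $A(G)$, whose $(i,j)$-entry is $1$ if vertices $v_i,v_j$ are adjacent and $0$ otherwise. *)

theory Defs
  imports "Graph_Theory.Pair_Digraph" "Jordan_Normal_Form.Char_Poly"
begin

text \<open>
  A simple undirected graph is a \<^locale>\<open>pair_graph\<close>: each edge is represented by both of its
  orientations. Lemma \<open>threshold_graph_pair_graph\<close> shows that the inductively generated graphs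
  below are of this kind; the fresh-vertex premises are what excludes loops.
\<close>

inductive threshold_graph :: "'a pair_pre_digraph \<Rightarrow> bool" where
  single: "threshold_graph \<lparr>pverts = {v}, parcs = {}\<rparr>"
| isolated: "threshold_graph G \<Longrightarrow> v \<notin> pverts G \<Longrightarrow>
    threshold_graph \<lparr>pverts = insert v (pverts G), parcs = parcs G\<rparr>"
| dominating: "threshold_graph G \<Longrightarrow> v \<notin> pverts G \<Longrightarrow>
    threshold_graph \<lparr>pverts = insert v (pverts G),
      parcs = parcs G \<union> {v} \<times> pverts G \<union> pverts G \<times> {v}\<rparr>"

lemma threshold_graph_pair_graph:
  assumes "threshold_graph G"
  shows "pair_graph G"
  using assms
proof (induction rule: threshold_graph.induct)
  case (single v)
  show ?case by unfold_locales (auto simp: arcs_ends_def symmetric_def)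
next
  case (isolated G v)
  then interpret pair_graph G by simp
  show ?case
  proof unfold_locales
    show "symmetric (with_proj \<lparr>pverts = insert v (pverts G), parcs = parcs G\<rparr>)"
      using pair_sym_arcs by (simp add: symmetric_def arcs_ends_def arc_to_ends_def)
  qed (auto dest: in_arcsD1 in_arcsD2 pair_no_loops)
next
  case (dominating G v)
  then interpret pair_graph G by simp
  show ?case
  proof unfold_locales
    show "symmetric (with_proj \<lparr>pverts = insert v (pverts G),
      parcs = parcs G \<union> {v} \<times> pverts G \<union> pverts G \<times> {v}\<rparr>)"
      using pair_sym_arcs by (auto simp: symmetric_def arcs_ends_def arc_to_ends_def sym_def)
  qed (use dominating.hyps in \<open>auto dest: in_arcsD1 in_arcsD2 pair_no_loops\<close>)
qed

text \<open>
  The matrix depends on the list \<open>vs\<close> that enumerates the vertices; it is meant to be used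
  with \<open>distinct vs\<close> and \<open>set vs = pverts G\<close>.
\<close>

definition adjacency_matrix :: "'a pair_pre_digraph \<Rightarrow> 'a list \<Rightarrow> real mat" where
  "adjacency_matrix G vs = mat (length vs) (length vs)
    (\<lambda>(i, j). if (vs ! i, vs ! j) \<in> parcs G then 1 else 0)"

end

theory Submission
  imports Defs
begin

text \<open>
  Build the graph vertex by vertex and follow the solutions of \<open>(A - \<mu> I) x = c \<one>\<close>. Put
  \<open>y = (\<Sum>v. x v - c) / (\<mu> + 1)\<close> and \<open>\<rho> = y / c\<close>. Restricting a solution to the graph
  without its last vertex shows that an isolated vertex acts by \<open>\<rho> \<mapsto> \<rho> - 1 / (\<mu> (\<mu> + 1))\<close>
  and a dominating one by \<open>\<rho> \<mapsto> \<rho> / (1 + \<rho>)\<close>, while a single vertex has \<open>\<rho> = - 1 / \<mu>\<close>.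
  An eigenvector is a nonzero solution with \<open>c = 0\<close>, i.e. \<open>\<rho> = \<infinity>\<close>, so it suffices to find a
  set of finite values of \<open>\<rho>\<close> that contains \<open>- 1 / \<mu>\<close> and is preserved by both maps.
  For \<open>\<mu> (\<mu> + 1) < 0\<close> the positive half-line works. For \<open>0 < \<mu> (\<mu> + 1) \<le> 1 / 4\<close>, which is
  exactly the rest of the interval, the set \<open>{..-2} \<union> {0..2}\<close> works.
\<close>

text \<open>The vector is a total function on the vertex type, so that the same \<open>x\<close>
  serves every graph of the construction.\<close>

definition shifted_solution :: "'a pair_pre_digraph \<Rightarrow> real \<Rightarrow> ('a \<Rightarrow> real) \<Rightarrow> real \<Rightarrow> bool" where
  "shifted_solution G \<mu> x c \<longleftrightarrow> (\<forall>v\<in>pverts G. sum x (parcs G `` {v}) - \<mu> * x v = c)"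

lemma shifted_solution_isolated:
  assumes "pair_graph G" "v \<notin> pverts G" "\<mu> \<noteq> 0"
    and "shifted_solution \<lparr>pverts = insert v (pverts G), parcs = parcs G\<rparr> \<mu> x c"
  shows "shifted_solution G \<mu> x c" "x v = - c / \<mu>"
proof -
  interpret pair_graph G by fact
  have "parcs G `` {v} = {}"
    using assms(2) by (auto dest: in_arcsD1)
  then show "shifted_solution G \<mu> x c" "x v = - c / \<mu>"
    using assms(3,4) by (auto simp: shifted_solution_def field_simps)
qed

text \<open>The new vertex adds \<open>x v\<close> to every old equation, which turns the constant
  into \<open>c - x v\<close>. Its own equation, rearranged, says that \<open>x v\<close> is the
  value y of the smaller graph for that constant.\<close>

lemma shifted_solution_dominating:
  assumes "pair_graph G" "v \<notin> pverts G" "\<mu> \<noteq> - 1"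
    and "shifted_solution \<lparr>pverts = insert v (pverts G),
      parcs = parcs G \<union> {v} \<times> pverts G \<union> pverts G \<times> {v}\<rparr> \<mu> x c"
  shows "shifted_solution G \<mu> x (c - x v)"
    and "x v = (sum x (pverts G) - (c - x v)) / (\<mu> + 1)"
proof -
  interpret pair_graph G by fact
  let ?E = "parcs G \<union> {v} \<times> pverts G \<union> pverts G \<times> {v}"
  have nbh: "?E `` {u} = insert v (parcs G `` {u})"
    and fin: "finite (parcs G `` {u})" and fresh: "v \<notin> parcs G `` {u}"
    if "u \<in> pverts G" for u
    using that assms(2) finite_subset[OF _ pair_finite_verts, of "parcs G `` {u}"]
    by (auto dest: in_arcsD2)
  show "shifted_solution G \<mu> x (c - x v)"
    unfolding shifted_solution_def
  proof
    fix u assume u: "u \<in> pverts G"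
    then have "sum x (?E `` {u}) - \<mu> * x u = c"
      using assms(4) by (simp add: shifted_solution_def)
    then show "sum x (parcs G `` {u}) - \<mu> * x u = c - x v"
      using nbh[OF u] fin[OF u] fresh[OF u] by simp
  qed
  have "?E `` {v} = pverts G"
    using assms(2) by (auto dest: in_arcsD1)
  then have "sum x (pverts G) - \<mu> * x v = c"
    using assms(4) by (simp add: shifted_solution_def)
  moreover have "\<mu> + 1 \<noteq> 0" using assms(3) by simp
  ultimately show "x v = (sum x (pverts G) - (c - x v)) / (\<mu> + 1)"
    by (simp add: field_simps)
qed

text \<open>The first alternative covers the trivial solution, which has no ratio. Together the two
  exclude a nonzero solution with \<open>c = 0\<close>. The induction generalises \<open>c\<close>
  because a dominating vertex changes it.\<close>

lemma threshold_solution_ratio: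
  assumes "threshold_graph G" "\<mu> \<noteq> 0" "\<mu> \<noteq> - 1"
    and start: "- 1 / \<mu> \<in> S"
    and iso: "\<And>\<rho>. \<rho> \<in> S \<Longrightarrow> \<rho> - 1 / (\<mu> * (\<mu> + 1)) \<in> S"
    and dom: "\<And>\<rho>. \<rho> \<in> S \<Longrightarrow> 1 + \<rho> \<noteq> 0 \<and> \<rho> / (1 + \<rho>) \<in> S"
    and "shifted_solution G \<mu> x c"
  shows "c = 0 \<and> (\<forall>v\<in>pverts G. x v = 0) \<or>
    c \<noteq> 0 \<and> (sum x (pverts G) - c) / (\<mu> + 1) / c \<in> S"
  using assms(1,7)
proof (induction arbitrary: c rule: threshold_graph.induct)
  case (single v)
  then have "c = - \<mu> * x v" by (simp add: shifted_solution_def)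
  moreover have "(x v + \<mu> * x v) / (\<mu> + 1) = x v"
    using assms(3) by (simp add: field_simps)
  ultimately show ?case using start assms(2) by auto
next
  case (isolated G v)
  interpret pair_graph G using isolated.hyps(1) by (rule threshold_graph_pair_graph)
  note sol = shifted_solution_isolated[OF pair_graph_axioms isolated.hyps(2) assms(2) isolated.prems]
  have sum: "sum x (insert v (pverts G)) = sum x (pverts G) - c / \<mu>"
    using isolated.hyps(2) sol(2) by simp
  from isolated.IH[OF sol(1)] show ?case
  proof
    assume "c = 0 \<and> (\<forall>v\<in>pverts G. x v = 0)"
    then show ?thesis using sol(2) by simp
  next
    assume *: "c \<noteq> 0 \<and> (sum x (pverts G) - c) / (\<mu> + 1) / c \<in> S"
    have "\<mu> + 1 \<noteq> 0" using assms(3) by simp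
    then have "(sum x (insert v (pverts G)) - c) / (\<mu> + 1) / c
      = (sum x (pverts G) - c) / (\<mu> + 1) / c - 1 / (\<mu> * (\<mu> + 1))"
      unfolding sum using * assms(2) by (simp add: divide_simps) (simp add: algebra_simps)
    then show ?thesis using * iso by simp
  qed
next
  case (dominating G v)
  interpret pair_graph G using dominating.hyps(1) by (rule threshold_graph_pair_graph)
  note sol = shifted_solution_dominating[OF pair_graph_axioms dominating.hyps(2) assms(3) dominating.prems]
  have sum: "sum x (insert v (pverts G)) - c = sum x (pverts G) - (c - x v)"
    using dominating.hyps(2) by simp
  from dominating.IH[OF sol(1)] show ?case
  proof
    assume "c - x v = 0 \<and> (\<forall>v\<in>pverts G. x v = 0)"
    then show ?thesis using sol(2) by simp
  next
    let ?b = "c - x v"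
    assume *: "?b \<noteq> 0 \<and> (sum x (pverts G) - ?b) / (\<mu> + 1) / ?b \<in> S"
    \<comment> \<open>Both graphs have y equal to \<open>x v\<close>. Only the constant changes,
      from \<open>?b\<close> to \<open>c = ?b + x v\<close>, a factor of 1 + \<rho>; this factor
      being nonzero gives \<open>c \<noteq> 0\<close>.\<close>
    then have "x v / ?b \<in> S" using sol(2) by simp
    from dom[OF this] have "1 + x v / ?b \<noteq> 0" "x v / ?b / (1 + x v / ?b) \<in> S" by auto
    moreover have "1 + x v / ?b = c / ?b" using * by (simp add: field_simps)
    ultimately have "c \<noteq> 0" "x v / c \<in> S" using * by auto
    moreover have "(sum x (insert v (pverts G)) - c) / (\<mu> + 1) = x v"
      unfolding sum by (rule sol(2)[symmetric])
    ultimately show ?thesis by simp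
  qed
qed

lemma eigenvalue_adjacency_matrix_solution:
  assumes "pair_graph G" "distinct vs" "set vs = pverts G"
    and "eigenvalue (adjacency_matrix G vs) \<mu>"
  obtains x v where "shifted_solution G \<mu> x 0" "v \<in> pverts G" "x v \<noteq> 0"
proof -
  interpret pair_graph G by fact
  let ?A = "adjacency_matrix G vs" and ?n = "length vs"
  obtain w where w: "w \<in> carrier_vec ?n" "w \<noteq> 0\<^sub>v ?n" "?A *\<^sub>v w = \<mu> \<cdot>\<^sub>v w"
    using assms(4) by (auto simp: eigenvalue_def eigenvector_def adjacency_matrix_def)
  have bij: "bij_betw ((!) vs) {0..<?n} (pverts G)"
    using bij_betw_nth[OF assms(2) _ assms(3)[symmetric]] by (simp add: atLeast0LessThan)
  \<comment> \<open>Inverting the enumeration carries the eigenvector from indices to vertices; its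
    values outside the graph are irrelevant.\<close>
  define x where "x u = w $ the_inv_into {0..<?n} ((!) vs) u" for u
  have x_nth: "x (vs ! i) = w $ i" if "i < ?n" for i
    using that bij by (simp add: x_def the_inv_into_f_f bij_betw_def)
  have sol: "sum x (parcs G `` {vs ! i}) - \<mu> * x (vs ! i) = 0" if i: "i < ?n" for i
  proof -
    have "sum x (parcs G `` {vs ! i})
      = (\<Sum>u\<in>pverts G. if (vs ! i, u) \<in> parcs G then x u else 0)"
      by (rule sum.mono_neutral_cong_left) (auto dest: in_arcsD2)
    also have "\<dots> = (\<Sum>j\<in>{0..<?n}. if (vs ! i, vs ! j) \<in> parcs G then x (vs ! j) else 0)"
      by (rule sum.reindex_bij_betw[OF bij, symmetric])
    also have "\<dots> = (?A *\<^sub>v w) $ i"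
      using i w(1) by (auto simp: adjacency_matrix_def scalar_prod_def x_nth intro!: sum.cong)
    also have "\<dots> = \<mu> * x (vs ! i)"
      using i w(1,3) by (simp add: x_nth)
    finally show ?thesis by simp
  qed
  obtain i where i: "i < ?n" "w $ i \<noteq> 0"
    using w(1,2) by (metis carrier_vecD eq_vecI index_zero_vec)
  show ?thesis
  proof (rule that)
    show "shifted_solution G \<mu> x 0"
      using sol by (auto simp: shifted_solution_def in_set_conv_nth simp flip: assms(3))
    show "vs ! i \<in> pverts G" "x (vs ! i) \<noteq> 0"
      using i assms(3) x_nth by auto
  qed
qed

lemma not_eigenvalue_threshold_graph:
  assumes "threshold_graph G" "distinct vs" "set vs = pverts G" "\<mu> \<noteq> 0" "\<mu> \<noteq> - 1"
    and "- 1 / \<mu> \<in> S"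
    and "\<And>\<rho>. \<rho> \<in> S \<Longrightarrow> \<rho> - 1 / (\<mu> * (\<mu> + 1)) \<in> S"
    and "\<And>\<rho>. \<rho> \<in> S \<Longrightarrow> 1 + \<rho> \<noteq> 0 \<and> \<rho> / (1 + \<rho>) \<in> S"
  shows "\<not> eigenvalue (adjacency_matrix G vs) \<mu>"
proof
  assume "eigenvalue (adjacency_matrix G vs) \<mu>"
  then obtain x v where "shifted_solution G \<mu> x 0" "v \<in> pverts G" "x v \<noteq> 0"
    using eigenvalue_adjacency_matrix_solution threshold_graph_pair_graph assms(1-3) by blast
  then show False
    using threshold_solution_ratio[OF assms(1,4-8)] by blast
qed

theorem theorem3p5:
  fixes G :: "'a pair_pre_digraph" and vs :: "'a list" and \<mu> :: real
  assumes "threshold_graph G"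
    and "distinct vs" and "set vs = pverts G"
    and "eigenvalue (adjacency_matrix G vs) \<mu>"
    and "\<mu> \<notin> {-1, 0}"
  shows "\<mu> \<notin> {(-1 - sqrt 2) / 2 .. (-1 + sqrt 2) / 2}"
proof
  assume "\<mu> \<in> {(-1 - sqrt 2) / 2 .. (-1 + sqrt 2) / 2}"
  \<comment> \<open>The interval is centred at -1/2, and the square of 2 \<mu> + 1 is 4 \<mu> (\<mu>
    + 1) + 1.\<close>
  then have "\<bar>2 * \<mu> + 1\<bar> \<le> sqrt 2" by (auto simp: abs_le_iff)
  then have "(2 * \<mu> + 1)\<^sup>2 \<le> 2"
    by (metis abs_ge_zero power2_abs power_mono real_sqrt_pow2 zero_le_numeral)
  then have bound: "4 * (\<mu> * (\<mu> + 1)) \<le> 1"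
    by (simp add: power2_eq_square algebra_simps)
  have nz: "\<mu> \<noteq> 0" "\<mu> \<noteq> - 1" using assms(5) by auto
  note no_eigenvalue = not_eigenvalue_threshold_graph[OF assms(1-3) nz]
  consider "- 1 < \<mu>" "\<mu> < 0" | "\<mu> > 0 \<or> \<mu> < - 1"
    using nz by linarith
  then show False
  proof cases
    case 1
    then have "\<mu> * (\<mu> + 1) < 0" by (simp add: mult_neg_pos)
    then have "1 / (\<mu> * (\<mu> + 1)) < 0" by simp
    then have "\<rho> - 1 / (\<mu> * (\<mu> + 1)) > 0" if "\<rho> > 0" for \<rho>
      using that by linarith
    then have "\<not> eigenvalue (adjacency_matrix G vs) \<mu>"
      using 1 by (intro no_eigenvalue[of "{0<..}"]) (simp_all add: divide_neg_neg)
    then show False using assms(4) by blast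
  next
    case 2
    have pos: "\<mu> * (\<mu> + 1) > 0"
      using 2 by (auto simp: zero_less_mult_iff)
    \<comment> \<open>A shift down by at least 4 takes \<open>{0..2}\<close> into
      \<open>{..- 2}\<close>, across the gap that holds the pole -1 of \<rho> / (1 +
      \<rho>).\<close>
    have ge4: "1 / (\<mu> * (\<mu> + 1)) \<ge> 4"
      using bound pos by (simp add: le_divide_eq)
    have "\<not> eigenvalue (adjacency_matrix G vs) \<mu>"
    proof (rule no_eigenvalue[of "{..- 2} \<union> {0..2}"])
      show "- 1 / \<mu> \<in> {..- 2} \<union> {0..2}"
      \<comment> \<open>The start is at most -4 if \<mu> > 0, and between 0 and 1 if \<mu> <
        -1.\<close>
      proof (cases "\<mu> > 0")
        case True
        then have "\<mu> \<le> \<mu> * (\<mu> + 1)" by simp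
        then have "\<mu> * 4 \<le> 1" using bound by linarith
        then show ?thesis using True by (simp add: field_simps)
      next
        case False
        then show ?thesis using 2 by (auto simp: field_simps)
      qed
      show "\<rho> - 1 / (\<mu> * (\<mu> + 1)) \<in> {..- 2} \<union> {0..2}" if "\<rho> \<in> {..- 2} \<union> {0..2}" for \<rho>
        using that ge4 by auto
      \<comment> \<open>Written as 1 - 1 / (1 + \<rho>), the image lies in (1, 2] for \<rho> \<le>
        -2 and in [0, 1) for \<rho> \<ge> 0.\<close>
      show "1 + \<rho> \<noteq> 0 \<and> \<rho> / (1 + \<rho>) \<in> {..- 2} \<union> {0..2}" if "\<rho> \<in> {..- 2} \<union> {0..2}" for \<rho> :: real
        using that by (auto simp: divide_le_eq le_divide_eq)
    qed
    then show False using assms(4) by blast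
  qed
qed

end
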